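(* Let $p>q>1$ be coprime integers. Then for every integer $n\ge 1$, $$P_{\Xi_{p/q}}(n)=pq\,(p^{n-1}-q^{n-1})\,\frac{q-1}{p-q}+p^nq .$$
   Context: For $n\ge 2$ let $\Sigma_n=\{0,1,\dots,n-1\}$. For a finite alphabet $A$ and $X\subseteq A^{\mathbb{Z}}$, the complexity function $P_X(n)$ is the number of words of length $n$ over $A$ that occur as subwords $x[i]x[i+1]\cdots x[i+n-1]$ of elements $x\in X$. For coprime integers $s,t>1$, write $a,b\in\Sigma_{st}$ uniquely as $a=a_1t+a_0$, $b=b_1t+b_0$ with $a_0,b_0\in\Sigma_t$, $a_1,b_1\in\Sigma_s$, and put $g_{s,st}(a,b)=a_0s+b_1$. Let $f_{s/t,st}(a,c,b)=g_{s,st}(g_{s,st}(a,c),g_{s,st}(c,b))$. The multiplication automaton $\Pi_{s/t,st}:\Sigma_{st}^{\mathbb{Z}}\to\Sigma_{st}^{\mathbb{Z}}$ is $\Pi_{s/t,st}(x)[i]=f_{s/t,st}(x[i-1],x[i],x[i+1])$; it is a bijection with inverse $\Pi_{t/s,st}$ and it multiplies by $s/t$ in base $st$. The trace of $x\in\Sigma_{st}^{\mathbb{Z}}$ is $\mathrm{Tr}_{s/t}(x)\in\Sigma_{st}^{\mathbb{Z}}$, $\mathrm{Tr}_{s/t}(x)[k]=\Pi_{s/t,st}^k(x)[0]$ for $k\in\mathbb{Z}$, and the trace subshift is $\Xi_{s/t}=\mathrm{Tr}_{s/t}(\Sigma_{st}^{\mathbb{Z}})$. *)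

theory Defs
  imports Complex_Main
begin

definition Sigma_digits :: "nat \<Rightarrow> nat set" where
  "Sigma_digits n = {0..<n}"

definition configs :: "'a set \<Rightarrow> (int \<Rightarrow> 'a) set" where
  "configs A = {x. range x \<subseteq> A}"

definition subwords :: "(int \<Rightarrow> 'a) set \<Rightarrow> nat \<Rightarrow> 'a list set" where
  "subwords X n = {map (\<lambda>j. x (i + int j)) [0..<n] | x i. x \<in> X}"

definition complexity :: "(int \<Rightarrow> 'a) set \<Rightarrow> nat \<Rightarrow> nat" where
  "complexity X n = card (subwords X n)"

(* For a = a1 * t + a0 with a0 < t the digits are a0 = a mod t and a1 = a div t. *)
definition g_mult :: "nat \<Rightarrow> nat \<Rightarrow> nat \<Rightarrow> nat \<Rightarrow> nat" where
  "g_mult s t a b = (a mod t) * s + b div t"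

definition f_mult :: "nat \<Rightarrow> nat \<Rightarrow> nat \<Rightarrow> nat \<Rightarrow> nat \<Rightarrow> nat" where
  "f_mult s t a c b = g_mult s t (g_mult s t a c) (g_mult s t c b)"

definition mult_aut :: "nat \<Rightarrow> nat \<Rightarrow> (int \<Rightarrow> nat) \<Rightarrow> (int \<Rightarrow> nat)" where
  "mult_aut s t x = (\<lambda>i. f_mult s t (x (i - 1)) (x i) (x (i + 1)))"

lemma g_mult_less:
  assumes "s > 0" "t > 0" "b < s * t"
  shows "g_mult s t a b < s * t"
proof -
  have "b div t < s" using assms by (simp add: less_mult_imp_div_less)
  moreover have "a mod t + 1 \<le> t" using assms by (simp add: Suc_leI)
  then have "(a mod t + 1) * s \<le> t * s" by (rule mult_le_mono1)
  ultimately show ?thesis by (simp add: g_mult_def algebra_simps)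
qed

lemma g_mult_g_mult:
  assumes "b < s * t" "c < s * t"
  shows "g_mult t s (g_mult s t a c) (g_mult s t c b) = c"
proof -
  have "c div t < s" "b div t < s" using assms by (simp_all add: less_mult_imp_div_less)
  then show ?thesis by (simp add: g_mult_def)
qed

lemma mult_aut_in_configs:
  assumes "s > 0" "t > 0" "x \<in> configs (Sigma_digits (s * t))"
  shows "mult_aut s t x \<in> configs (Sigma_digits (s * t))"
  using assms
  by (auto simp: configs_def Sigma_digits_def mult_aut_def f_mult_def image_subset_iff
      intro!: g_mult_less)

lemma mult_aut_mult_aut:
  assumes "s > 0" "t > 0" "x \<in> configs (Sigma_digits (s * t))"
  shows "mult_aut t s (mult_aut s t x) = x"
proof
  fix i :: int
  have x: "x j < s * t" for j
    using assms by (auto simp: configs_def Sigma_digits_def image_subset_iff)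
  note g = g_mult_less[OF assms(1,2)]
  have *: "i - 1 + 1 = i" "i + 1 - 1 = i" by simp_all
  show "mult_aut t s (mult_aut s t x) i = x i"
    unfolding mult_aut_def f_mult_def * by (simp add: g_mult_g_mult g x)
qed

lemma bij_betw_mult_aut:
  assumes "s > 0" "t > 0"
  shows "bij_betw (mult_aut s t) (configs (Sigma_digits (s * t))) (configs (Sigma_digits (s * t)))"
  by (rule bij_betw_byWitness[where f' = "mult_aut t s"])
    (use assms mult_aut_mult_aut[of s t] mult_aut_mult_aut[of t s]
      mult_aut_in_configs[of s t] mult_aut_in_configs[of t s] in \<open>auto simp: mult.commute\<close>)

(* Negative powers iterate the inverse of the bijection that mult_aut s t induces on the
   configurations over Sigma_digits (s * t); that inverse is mult_aut t s. *)
definition mult_aut_power :: "nat \<Rightarrow> nat \<Rightarrow> int \<Rightarrow> (int \<Rightarrow> nat) \<Rightarrow> (int \<Rightarrow> nat)" where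
  "mult_aut_power s t k =
     (if k \<ge> 0 then mult_aut s t ^^ nat k
      else inv_into (configs (Sigma_digits (s * t))) (mult_aut s t) ^^ nat (- k))"

lemma inv_into_mult_aut:
  assumes "s > 0" "t > 0" "x \<in> configs (Sigma_digits (s * t))"
  shows "inv_into (configs (Sigma_digits (s * t))) (mult_aut s t) x = mult_aut t s x"
proof (rule inv_into_f_eq)
  show "inj_on (mult_aut s t) (configs (Sigma_digits (s * t)))"
    using bij_betw_mult_aut[OF assms(1,2)] by (rule bij_betw_imp_inj_on)
  show "mult_aut t s x \<in> configs (Sigma_digits (s * t))"
    using mult_aut_in_configs[of t s x] assms by (simp add: mult.commute)
  show "mult_aut s t (mult_aut t s x) = x"
    using mult_aut_mult_aut[of t s x] assms by (simp add: mult.commute)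
qed

definition trace :: "nat \<Rightarrow> nat \<Rightarrow> (int \<Rightarrow> nat) \<Rightarrow> (int \<Rightarrow> nat)" where
  "trace s t x = (\<lambda>k. mult_aut_power s t k x 0)"

definition trace_subshift :: "nat \<Rightarrow> nat \<Rightarrow> (int \<Rightarrow> nat) set" where
  "trace_subshift s t = trace s t ` configs (Sigma_digits (s * t))"

end

theory Submission
  imports Defs
begin

text \<open>
  A nonnegative real \<open>X\<close> written in base \<open>p q\<close> is a configuration on which the automaton acts as
  multiplication by \<open>p / q\<close>, and every configuration agrees with such an expansion on any given
  finite window.  Hence the words of length \<open>n = m + 1\<close> of the trace subshift are the sequences
  \<open>\<lfloor>X (p / q)^k\<rfloor> mod p q\<close> for \<open>k \<le> m\<close>.  Scaling by \<open>p^m\<close>, these are the sequences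
  \<open>(M div D\<^sub>k) mod p q\<close> with \<open>D\<^sub>k = p^(m - k) q^k\<close>; they only change when \<open>M\<close> passes a multiple
  of some \<open>D\<^sub>k\<close> and have period \<open>p^n q^n\<close>.  Conversely the word determines the
  quotients: \<open>q (M div D\<^sub>k\<^sub>+\<^sub>1) - p (M div D\<^sub>k)\<close> is known modulo \<open>p q\<close> and lies in a range of
  \<open>p + q - 1\<close> values, so it is known exactly.  The complexity is therefore the number of
  multiples of the \<open>D\<^sub>k\<close> in a period.
\<close>

section \<open>Multiplication by \<open>s / t\<close> on expansions of nonnegative reals\<close>

definition digits :: "nat \<Rightarrow> real \<Rightarrow> int \<Rightarrow> nat" where
  "digits B X i = nat \<lfloor>X * real B powi i\<rfloor> mod B"

lemma nat_floor_divide: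
  assumes "x \<ge> 0"
  shows "nat \<lfloor>x / real b\<rfloor> = nat \<lfloor>x\<rfloor> div b"
  using floor_divide_real_eq_div[of "int b" x] assms by (simp add: nat_div_distrib)

text \<open>Modulo \<open>s * t\<close>, the number \<open>v div t\<close> consists of a low part
  modulo \<open>s\<close>, which is the last digit of \<open>v\<close> divided by \<open>t\<close>,
  and a high part, the residue modulo \<open>t\<close> of the digit before it. These are the two
  summands of \<open>g_mult\<close>.\<close>

lemma g_mult_digit_pair:
  "g_mult s t (v div (s * t) mod (s * t)) (v mod (s * t)) = v div t mod (s * t)"
proof -
  have "v div (s * t) mod (s * t) mod t = v div t div s mod t"
    by (simp add: div_mult2_eq[symmetric] mod_mod_cancel mult.commute)
  moreover have "v mod (s * t) div t = v div t mod s"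
    by (cases "t = 0") (simp_all add: mult.commute[of s] mod_mult2_eq)
  ultimately show ?thesis
    by (simp add: g_mult_def mod_mult2_eq mult.commute)
qed

lemma g_mult_digits:
  assumes "X \<ge> 0" "s > 0" "t > 0"
  shows "g_mult s t (digits (s * t) X i) (digits (s * t) X (i + 1)) = digits (s * t) (real s * X) i"
proof -
  \<comment> \<open>Both neighbouring digits come from \<open>Y\<close>, namely from
    \<open>Y / (s * t)\<close> and \<open>Y\<close>, while digit \<open>i\<close> of
    \<open>s * X\<close> comes from \<open>Y / t\<close>.\<close>
  define Y where "Y = X * real (s * t) powi (i + 1)"
  have Y: "Y \<ge> 0" using assms by (simp add: Y_def)
  have B: "real (s * t) \<noteq> 0" using assms by simp
  have "X * real (s * t) powi i = Y / real (s * t)"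
    using B unfolding Y_def by (subst power_int_add_1) auto
  moreover have "real s * X * real (s * t) powi i = Y / real t"
    using B unfolding Y_def by (subst power_int_add_1) (auto simp: field_simps)
  ultimately show ?thesis
    using Y unfolding digits_def Y_def[symmetric]
    by (simp only: nat_floor_divide g_mult_digit_pair)
qed

text \<open>Two layers of \<open>g_mult\<close> multiply by \<open>s * s\<close>. Reading the result
  one position to the left divides by the base \<open>s * t\<close>, which leaves the factor
  \<open>s / t\<close>.\<close>

lemma mult_aut_digits:
  assumes "X \<ge> 0" "s > 0" "t > 0"
  shows "mult_aut s t (digits (s * t) X) = digits (s * t) (real s / real t * X)"
proof
  fix i
  have "mult_aut s t (digits (s * t) X) i = digits (s * t) (real s * (real s * X)) (i - 1)"
    using g_mult_digits[of X s t "i - 1"] g_mult_digits[of X s t i]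
      g_mult_digits[of "real s * X" s t "i - 1"] assms
    by (simp add: mult_aut_def f_mult_def)
  also have "\<dots> = digits (s * t) (real s / real t * X) i"
    using assms by (simp add: digits_def power_int_diff field_simps)
  finally show "mult_aut s t (digits (s * t) X) i = digits (s * t) (real s / real t * X) i" .
qed

lemma funpow_mult_aut_digits:
  assumes "X \<ge> 0" "s > 0" "t > 0"
  shows "(mult_aut s t ^^ k) (digits (s * t) X) = digits (s * t) ((real s / real t) ^ k * X)"
  by (induction k) (use assms in \<open>simp_all add: mult_aut_digits mult.assoc\<close>)

section \<open>Locality and approximation on finite windows\<close>

lemma funpow_mult_aut_cong:
  assumes "\<And>i. \<bar>i\<bar> \<le> int k + r \<Longrightarrow> x i = y i" "\<bar>i\<bar> \<le> r"
  shows "(mult_aut s t ^^ k) x i = (mult_aut s t ^^ k) y i"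
  using assms
proof (induction k arbitrary: r i)
  case 0
  then show ?case by simp
next
  case (Suc k)
  \<comment> \<open>The automaton has radius 1, so the induction hypothesis is taken on a window
    wider by one cell.\<close>
  have "(mult_aut s t ^^ k) x j = (mult_aut s t ^^ k) y j" if "\<bar>j\<bar> \<le> r + 1" for j
    by (rule Suc.IH[of "r + 1"]) (use Suc.prems that in auto)
  with Suc.prems(2) show ?case by (simp add: mult_aut_def[of s t "(mult_aut s t ^^ k) _"])
qed

lemma exists_nat_with_digits:
  fixes B :: nat
  assumes "\<And>j. d j < B"
  shows "\<exists>N. \<forall>j<m. N div B ^ j mod B = d j"
  using assms
proof (induction m arbitrary: d)
  case 0
  then show ?case by simp
next
  case (Suc m)
  obtain N where N: "\<And>j. j < m \<Longrightarrow> N div B ^ j mod B = d (Suc j)"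
    using Suc.IH[of "d \<circ> Suc"] Suc.prems by auto
  have "B > 0" using Suc.prems[of 0] by simp
  then have "(d 0 + B * N) div B ^ j mod B = d j" if "j < Suc m" for j
    using that N Suc.prems[of 0] by (cases j) (auto simp: div_mult2_eq)
  then show ?case by blast
qed

lemma exists_digits_window:
  assumes "x \<in> configs (Sigma_digits B)"
  obtains X where "X \<ge> 0" "\<And>i. \<bar>i\<bar> \<le> int n \<Longrightarrow> digits B X i = x i"
proof -
  have x: "x i < B" for i
    using assms by (auto simp: configs_def Sigma_digits_def image_subset_iff)
  then have B: "B > 0" using gr_zeroI by fastforce
  \<comment> \<open>The window has \<open>2 * n + 1\<close> positions. The rightmost is least
    significant, hence the reversed order; dividing \<open>N\<close> by \<open>B ^ n\<close> puts
    its lowest digit at position \<open>n\<close>.\<close>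
  obtain N where N: "\<And>j. j < 2 * n + 1 \<Longrightarrow> N div B ^ j mod B = x (int n - int j)"
    using exists_nat_with_digits[of "\<lambda>j. x (int n - int j)" B "2 * n + 1"] x by blast
  have "digits B (real N / real B ^ n) i = x i" if "\<bar>i\<bar> \<le> int n" for i
  proof -
    define j where "j = nat (int n - i)"
    have i: "i = int n - int j" and j: "j < 2 * n + 1" using that by (auto simp: j_def)
    have "real N / real B ^ n * real B powi i = real N / real (B ^ j)"
      using B by (simp add: i power_int_diff)
    then have "nat \<lfloor>real N / real B ^ n * real B powi i\<rfloor> = N div B ^ j"
      by (simp only: nat_floor_divide[OF of_nat_0_le_iff]) simp
    then show ?thesis using N[OF j] by (simp add: digits_def i)
  qed
  then show thesis by (intro that[of "real N / real B ^ n"]) auto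
qed

section \<open>Integer powers of the automaton and words of the trace\<close>

lemma mult_aut_power_in_configs:
  assumes "s > 0" "t > 0" "x \<in> configs (Sigma_digits (s * t))"
  shows "mult_aut_power s t k x \<in> configs (Sigma_digits (s * t))"
proof -
  let ?C = "configs (Sigma_digits (s * t))"
  have inv: "inv_into ?C (mult_aut s t) y \<in> ?C" if "y \<in> ?C" for y
    using bij_betw_inv_into[OF bij_betw_mult_aut] assms that by (auto simp: bij_betw_def)
  have "(mult_aut s t ^^ j) x \<in> ?C" for j
    by (induction j) (use assms mult_aut_in_configs in auto)
  moreover have "(inv_into ?C (mult_aut s t) ^^ j) x \<in> ?C" for j
    by (induction j) (use assms inv in auto)
  ultimately show ?thesis by (simp add: mult_aut_power_def)
qed

lemma mult_aut_power_Suc: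
  assumes "s > 0" "t > 0" "x \<in> configs (Sigma_digits (s * t))"
  shows "mult_aut_power s t (k + 1) x = mult_aut s t (mult_aut_power s t k x)"
proof (cases "k \<ge> 0")
  case True
  then have "nat (k + 1) = Suc (nat k)" by simp
  with True show ?thesis by (simp add: mult_aut_power_def)
next
  case False
  let ?C = "configs (Sigma_digits (s * t))"
  have k: "nat (- k) = Suc (nat (- (k + 1)))" using False by simp
  define y where "y = (inv_into ?C (mult_aut s t) ^^ nat (- (k + 1))) x"
  \<comment> \<open>At \<open>k = -1\<close> the definition switches branches; zero iterations of
    either map give \<open>x\<close>.\<close>
  have y: "mult_aut_power s t (k + 1) x = y"
    using False by (cases "k = -1") (auto simp: mult_aut_power_def y_def)
  then have "y \<in> ?C" using mult_aut_power_in_configs[OF assms, of "k + 1"] by simp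
  moreover have "mult_aut_power s t k x = inv_into ?C (mult_aut s t) y"
    using False by (simp add: mult_aut_power_def k y_def del: minus_add_distrib)
  ultimately show ?thesis
    using y bij_betw_inv_into_right[OF bij_betw_mult_aut[OF assms(1,2)]] by simp
qed

lemma mult_aut_power_add:
  assumes "s > 0" "t > 0" "x \<in> configs (Sigma_digits (s * t))"
  shows "mult_aut_power s t (i + int j) x = (mult_aut s t ^^ j) (mult_aut_power s t i x)"
proof (induction j)
  case (Suc j)
  then show ?case using mult_aut_power_Suc[OF assms, of "i + int j"] by (simp add: algebra_simps)
qed simp

text \<open>The starting time \<open>i\<close>, possibly negative, is absorbed by moving from
  \<open>x\<close> to \<open>mult_aut_power s t i x\<close>, again a configuration. So it suffices
  to read words from time 0.\<close>

lemma subwords_trace_subshift: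
  assumes "s > 0" "t > 0"
  shows "subwords (trace_subshift s t) n =
    (\<lambda>x. map (\<lambda>j. (mult_aut s t ^^ j) x 0) [0..<n]) ` configs (Sigma_digits (s * t))"
    (is "_ = ?w ` ?C")
proof (intro equalityI subsetI)
  fix u assume "u \<in> subwords (trace_subshift s t) n"
  then obtain x i where x: "x \<in> ?C" and u: "u = map (\<lambda>j. trace s t x (i + int j)) [0..<n]"
    by (auto simp: subwords_def trace_subshift_def)
  have "u = ?w (mult_aut_power s t i x)"
    using mult_aut_power_add[OF assms x] by (simp add: u trace_def)
  with mult_aut_power_in_configs[OF assms x] show "u \<in> ?w ` ?C" by blast
next
  fix u assume "u \<in> ?w ` ?C"
  then obtain x where x: "x \<in> ?C" and u: "u = ?w x" by blast
  have "u = map (\<lambda>j. trace s t x (0 + int j)) [0..<n]"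
    by (simp add: u trace_def mult_aut_power_def)
  with x show "u \<in> subwords (trace_subshift s t) n"
    unfolding subwords_def trace_subshift_def by blast
qed

section \<open>Words as residues of quotients of one natural number\<close>

definition quotient_word :: "nat \<Rightarrow> nat \<Rightarrow> nat \<Rightarrow> nat \<Rightarrow> nat list" where
  "quotient_word s t m M = map (\<lambda>k. M div (s ^ (m - k) * t ^ k) mod (s * t)) [0..<Suc m]"

lemma quotient_word_digits:
  assumes "X \<ge> 0" "s > 0" "t > 0"
  shows "map (\<lambda>j. (mult_aut s t ^^ j) (digits (s * t) X) 0) [0..<Suc m] =
    quotient_word s t m (nat \<lfloor>X * real s ^ m\<rfloor>)"
proof -
  have "(mult_aut s t ^^ k) (digits (s * t) X) 0 =
      nat \<lfloor>X * real s ^ m\<rfloor> div (s ^ (m - k) * t ^ k) mod (s * t)" if "k \<le> m" for k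
  proof -
    \<comment> \<open>This turns \<open>(s / t) ^ k\<close> into \<open>s ^ m\<close> over a natural
      number, so that only the floor of \<open>X * s ^ m\<close> matters.\<close>
    have "real s ^ m = real s ^ k * real s ^ (m - k)"
      using that by (simp add: power_add[symmetric])
    then have "(real s / real t) ^ k * X = X * real s ^ m / real (s ^ (m - k) * t ^ k)"
      using assms by (simp add: field_simps)
    then show ?thesis
      using assms nat_floor_divide[of "X * real s ^ m" "s ^ (m - k) * t ^ k"]
      by (simp add: funpow_mult_aut_digits digits_def)
  qed
  then show ?thesis
    unfolding quotient_word_def by (intro map_cong) (auto simp del: upt_Suc)
qed

lemma subwords_trace_subshift_eq_quotient_words:
  assumes "s > 0" "t > 0"
  shows "subwords (trace_subshift s t) (Suc m) = range (quotient_word s t m)"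
proof (intro equalityI subsetI)
  fix u assume "u \<in> subwords (trace_subshift s t) (Suc m)"
  then obtain x where x: "x \<in> configs (Sigma_digits (s * t))"
    and u: "u = map (\<lambda>j. (mult_aut s t ^^ j) x 0) [0..<Suc m]"
    unfolding subwords_trace_subshift[OF assms] by blast
  obtain X where X: "X \<ge> 0" "\<And>i. \<bar>i\<bar> \<le> int m \<Longrightarrow> digits (s * t) X i = x i"
    using exists_digits_window[OF x] by blast
  have "u = map (\<lambda>j. (mult_aut s t ^^ j) (digits (s * t) X) 0) [0..<Suc m]"
    unfolding u by (intro map_cong refl funpow_mult_aut_cong[where r = 0]) (use X in auto)
  then show "u \<in> range (quotient_word s t m)"
    using quotient_word_digits[OF X(1) assms] by simp
next
  fix u assume "u \<in> range (quotient_word s t m)"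
  then obtain M where u: "u = quotient_word s t m M" by blast
  define X where "X = real M / real s ^ m"
  have "nat \<lfloor>X * real s ^ m\<rfloor> = M" using assms by (simp add: X_def)
  moreover have "X \<ge> 0" by (simp add: X_def)
  ultimately have "u = map (\<lambda>j. (mult_aut s t ^^ j) (digits (s * t) X) 0) [0..<Suc m]"
    using quotient_word_digits[of X s t m] assms u by simp
  moreover have "digits (s * t) X \<in> configs (Sigma_digits (s * t))"
    using assms by (auto simp: configs_def Sigma_digits_def digits_def)
  ultimately show "u \<in> subwords (trace_subshift s t) (Suc m)"
    unfolding subwords_trace_subshift[OF assms] by blast
qed

text \<open>The bound \<open>j\<close> lets the count add one divisor at a time;
  \<open>j = Suc m\<close> gives the representatives of all words.\<close>

definition breakpoints :: "nat \<Rightarrow> nat \<Rightarrow> nat \<Rightarrow> nat \<Rightarrow> nat set" where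
  "breakpoints s t m j =
    {M. M < (s * t) ^ Suc m \<and> (\<exists>k<j. s ^ (m - k) * t ^ k dvd M)}"

lemma quotient_word_mod:
  "quotient_word s t m (M mod (s * t) ^ Suc m) = quotient_word s t m M"
proof (cases "s > 0 \<and> t > 0")
  case True
  have "M mod (s * t) ^ Suc m div (s ^ (m - k) * t ^ k) mod (s * t) =
      M div (s ^ (m - k) * t ^ k) mod (s * t)" if "k \<le> m" for k
  proof -
    define D where "D = s ^ (m - k) * t ^ k"
    have "s ^ m = s ^ (m - k) * s ^ k" "t ^ m = t ^ k * t ^ (m - k)"
      using that by (simp_all flip: power_add)
    \<comment> \<open>The cofactor of \<open>D\<close> in the period still contains a full factor
      \<open>s * t\<close>, so reducing \<open>M\<close> first keeps the quotient modulo
      \<open>s * t\<close>.\<close>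
    then have "(s * t) ^ Suc m = D * ((s ^ k * t ^ (m - k)) * (s * t))"
      by (simp add: D_def power_mult_distrib mult_ac)
    then obtain c where c: "(s * t) ^ Suc m = D * (c * (s * t))" by blast
    have D: "D > 0" using True by (simp add: D_def)
    have "M mod (D * (c * (s * t))) div D = M div D mod (c * (s * t))"
      using D by (simp add: mod_mult2_eq)
    then show ?thesis unfolding c D_def[symmetric] by (simp add: mod_mod_cancel)
  qed
  then show ?thesis
    unfolding quotient_word_def by (intro map_cong) (auto simp del: upt_Suc)
\<comment> \<open>Here \<open>s * t = 0\<close>, and reduction modulo 0 leaves \<open>M\<close>
  unchanged.\<close>
qed (auto simp: quotient_word_def)

lemma range_quotient_word:
  assumes "s > 0" "t > 0"
  shows "range (quotient_word s t m) = quotient_word s t m ` breakpoints s t m (Suc m)"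
proof (intro equalityI subsetI)
  fix u assume "u \<in> range (quotient_word s t m)"
  then obtain M where u: "u = quotient_word s t m M" and M: "M < (s * t) ^ Suc m"
    using quotient_word_mod[of s t m] assms
    by (smt (verit, ccfv_threshold) imageE mod_less_divisor mult_pos_pos zero_less_power)
  define D where "D k = s ^ (m - k) * t ^ k" for k
  have D: "D k > 0" for k using assms by (simp add: D_def)
  \<comment> \<open>\<open>R\<close> is the largest multiple of any \<open>D k\<close> not exceeding
    \<open>M\<close>; rounding down to it changes none of the quotients.\<close>
  define R where "R = Max ((\<lambda>k. D k * (M div D k)) ` {..m})"
  have R_ge: "D k * (M div D k) \<le> R" if "k \<le> m" for k
    unfolding R_def using that by (intro Max_ge) auto
  have "R \<in> (\<lambda>k. D k * (M div D k)) ` {..m}" unfolding R_def by (intro Max_in) auto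
  then obtain k where k: "k \<le> m" "R = D k * (M div D k)" by blast
  have RM: "R \<le> M" unfolding k by simp
  have "R div D k = M div D k" if "k \<le> m" for k
  proof (rule antisym)
    show "R div D k \<le> M div D k" using RM by (rule div_le_mono)
    show "M div D k \<le> R div D k"
      using R_ge[OF that] D by (simp add: less_eq_div_iff_mult_less_eq mult.commute)
  qed
  then have "quotient_word s t m R = u"
    unfolding u quotient_word_def D_def by (intro map_cong) (auto simp del: upt_Suc)
  moreover have "R \<in> breakpoints s t m (Suc m)"
    using k M le_less_trans[OF RM M] unfolding breakpoints_def D_def[symmetric]
    by (auto simp: less_Suc_eq_le simp del: power_Suc)
  ultimately show "u \<in> quotient_word s t m ` breakpoints s t m (Suc m)" by blast
qed auto

section \<open>Recovering the quotients from the word\<close>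

lemma int_dvd_abs_less_imp_zero:
  fixes e b :: int
  assumes "b dvd e" "\<bar>e\<bar> < b"
  shows "e = 0"
proof (rule ccontr)
  assume "e \<noteq> 0"
  then have "\<bar>b\<bar> \<le> \<bar>e\<bar>" using assms(1) by (rule dvd_imp_le_int)
  with assms(2) show False by linarith
qed

lemma consecutive_quotients:
  fixes M N E p q :: nat
  assumes "p > 0" "q > 0" "coprime p q"
    and "M div (p * E) mod (p * q) = N div (p * E) mod (p * q)"
    and "M div (q * E) mod (p * q) = N div (q * E) mod (p * q)"
  shows "int q * (int (M div (q * E)) - int (N div (q * E))) =
    int p * (int (M div (p * E)) - int (N div (p * E)))" (is "int q * ?dq = int p * ?dp")
proof -
  have quot: "int (K div E) = int p * int (K div (p * E)) + int (K div E mod p)"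
    "int (K div E) = int q * int (K div (q * E)) + int (K div E mod q)" for K
    by (simp_all add: mult.commute[of _ E] div_mult2_eq flip: of_nat_mult of_nat_add)
  let ?e = "int q * ?dq - int p * ?dp"
  \<comment> \<open>Dividing \<open>K div E\<close> by \<open>p\<close> and by \<open>q\<close>
    expresses the same number twice, so \<open>?e\<close> involves remainders only.\<close>
  have e: "?e = (int (M div E mod p) - int (N div E mod p)) - (int (M div E mod q) - int (N div E mod q))"
    using quot[of M] quot[of N] by (simp add: algebra_simps)
  have "M div E mod p < p" "N div E mod p < p" "M div E mod q < q" "N div E mod q < q"
    using assms by simp_all
  then have "\<bar>?e\<bar> \<le> (int p - 1) + (int q - 1)" unfolding e by linarith
  also have "\<dots> < int p * int q"
  proof -
    have "0 \<le> (int p - 1) * (int q - 1)" using assms by simp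
    then show ?thesis by (simp add: algebra_simps)
  qed
  finally have small: "\<bar>?e\<bar> < int (p * q)" by simp
  have "int (p * q) dvd ?dq" "int (p * q) dvd ?dp"
    using assms(4,5) by (metis mod_eq_dvd_iff of_nat_mod)+
  then have "int (p * q) dvd ?e" by (rule dvd_diff[OF dvd_mult dvd_mult])
  then have "?e = 0" using small by (rule int_dvd_abs_less_imp_zero)
  then show ?thesis by simp
qed

text \<open>By \<open>consecutive_quotients\<close> the differences \<open>d k\<close> of quotients
  form a geometric sequence with ratio \<open>p / q\<close>. As \<open>q\<close> divides
  \<open>d m\<close>, \<open>q ^ Suc m\<close> divides \<open>d 0\<close>; so does \<open>p\<close>,
  and the size of \<open>d 0\<close> then forces it, and with it every \<open>d k\<close>, to
  vanish.\<close>

lemma quotient_word_eqD: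
  assumes "p > 0" "q > 0" "coprime p q"
    and "M < (p * q) ^ Suc m" "N < (p * q) ^ Suc m"
    and eq: "quotient_word p q m M = quotient_word p q m N"
    and "k \<le> m"
  shows "M div (p ^ (m - k) * q ^ k) = N div (p ^ (m - k) * q ^ k)"
proof -
  define D where "D k = p ^ (m - k) * q ^ k" for k
  have D: "D k > 0" for k using assms by (simp add: D_def)
  have cong: "M div D k mod (p * q) = N div D k mod (p * q)" if "k \<le> m" for k
    using arg_cong[OF eq, of "\<lambda>w. w ! k"] that
    by (simp add: quotient_word_def D_def nth_map del: upt_Suc)
  define d where "d k = int (M div D k) - int (N div D k)" for k
  have step: "int q * d (Suc k) = int p * d k" if "k < m" for k
  proof -
    define E where "E = p ^ (m - Suc k) * q ^ k"
    have E: "D k = p * E" "D (Suc k) = q * E"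
      using that by (auto simp: D_def E_def Suc_diff_Suc simp flip: power_Suc)
    show ?thesis
      using consecutive_quotients[OF assms(1-3), of M E N] cong[of k] cong[of "Suc k"] that
      unfolding d_def E by auto
  qed
  have pow: "int q ^ k * d k = int p ^ k * d 0" if "k \<le> m" for k
    using that
  proof (induction k)
    case (Suc k)
    have "int q ^ Suc k * d (Suc k) = int q ^ k * (int q * d (Suc k))" by simp
    also have "\<dots> = int p * (int q ^ k * d k)" using step Suc.prems by simp
    also have "\<dots> = int p ^ Suc k * d 0" using Suc by simp
    finally show ?case .
  qed simp
  have dvd: "int (p * q) dvd d k" if "k \<le> m" for k
    using cong[OF that] unfolding d_def by (metis mod_eq_dvd_iff of_nat_mod)
  have cop: "coprime (int p) (int q)" using assms by simp
  have "int q dvd d m" using dvd[of m] by (auto elim: dvd_trans[rotated])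
  then have "int q ^ Suc m dvd int q ^ m * d m" by (simp add: mult.commute)
  then have "int q ^ Suc m dvd int p ^ m * d 0" using pow[of m] by simp
  moreover have "coprime (int q ^ Suc m) (int p ^ m)"
    using cop by (simp add: coprime_commute)
  ultimately have "int q ^ Suc m dvd d 0" by (simp add: coprime_dvd_mult_right_iff)
  moreover have "int p dvd d 0" using dvd[of 0] by (auto elim: dvd_trans[rotated])
  moreover have "coprime (int p) (int q ^ Suc m)" using cop by simp
  ultimately have dvd0: "int p * int q ^ Suc m dvd d 0" by (simp add: divides_mult)
  \<comment> \<open>Dividing the period by \<open>D 0 = p ^ m\<close> leaves exactly the divisor in
    \<open>dvd0\<close>.\<close>
  have bound: "K div D 0 < p * q ^ Suc m" if "K < (p * q) ^ Suc m" for K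
    using that D[of 0]
    by (simp add: D_def less_mult_imp_div_less power_mult_distrib mult.commute mult.left_commute)
  have "\<bar>d 0\<bar> < int (p * q ^ Suc m)"
    using bound[OF assms(4)] bound[OF assms(5)] unfolding d_def by linarith
  then have "d 0 = 0" using dvd0 by (intro int_dvd_abs_less_imp_zero) simp_all
  with pow[OF assms(7)] assms(2) have "d k = 0" by simp
  then show ?thesis by (simp add: d_def D_def)
qed

text \<open>If \<open>D\<close> is one of the divisors and divides \<open>M\<close>, then
  \<open>M = D * (M div D) = D * (N div D)\<close>, which is at most \<open>N\<close>. Exchanging
  the roles of \<open>M\<close> and \<open>N\<close> gives equality.\<close>

lemma inj_on_quotient_word:
  assumes "p > 0" "q > 0" "coprime p q"
  shows "inj_on (quotient_word p q m) (breakpoints p q m (Suc m))"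
proof -
  have le: "M \<le> N" if "M \<in> breakpoints p q m (Suc m)" "N \<in> breakpoints p q m (Suc m)"
    "quotient_word p q m M = quotient_word p q m N" for M N
  proof -
    from that obtain k where "k \<le> m" and k: "p ^ (m - k) * q ^ k dvd M"
      by (auto simp: breakpoints_def less_Suc_eq_le)
    then have "M div (p ^ (m - k) * q ^ k) = N div (p ^ (m - k) * q ^ k)"
      using quotient_word_eqD[OF assms] that by (auto simp: breakpoints_def)
    with k show ?thesis by (metis div_times_less_eq_dividend dvd_div_mult_self)
  qed
  show ?thesis by (intro inj_onI antisym) (auto intro: le)
qed

section \<open>Counting the breakpoints\<close>

lemma card_multiples_less:
  fixes d :: nat
  assumes "d > 0"
  shows "card {M. M < d * c \<and> d dvd M} = c"
proof -
  have "{M. M < d * c \<and> d dvd M} = (*) d ` {..<c}" using assms by (auto elim!: dvdE)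
  then show ?thesis using assms by (simp add: card_image inj_on_def)
qed

text \<open>When the multiples of \<open>D (Suc j)\<close> are added, those already present are
  exactly the multiples of \<open>E\<close>, the lcm of \<open>D j\<close> and
  \<open>D (Suc j)\<close>: every earlier \<open>D k\<close> contains \<open>p ^ (m - j)\<close>.
  The overlaps stand on the left to avoid subtraction in \<open>nat\<close>.\<close>

lemma card_breakpoints:
  assumes "p > 0" "q > 0" "coprime p q" "j \<le> m"
  shows "card (breakpoints p q m (Suc j)) + (\<Sum>i<j. p ^ Suc i * q ^ (m - i)) =
    (\<Sum>i\<le>j. p ^ Suc i * q ^ (Suc m - i))"
  using assms(4)
proof (induction j)
  case 0
  have "breakpoints p q m (Suc 0) = {M. M < p ^ m * (p * q ^ Suc m) \<and> p ^ m dvd M}"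
    by (simp add: breakpoints_def power_mult_distrib mult_ac)
  then show ?case using card_multiples_less[of "p ^ m" "p * q ^ Suc m"] assms by simp
next
  case (Suc j)
  define T where "T = (p * q) ^ Suc m"
  define D where "D k = p ^ (m - k) * q ^ k" for k
  define E where "E = p ^ (m - j) * q ^ Suc j"
  define S where "S = {M. M < T \<and> D (Suc j) dvd M}"
  have T: "T = p ^ a * q ^ b * (p ^ c * q ^ d)" if "a + c = Suc m" "b + d = Suc m" for a b c d
  proof -
    have "T = p ^ (a + c) * q ^ (b + d)" by (simp only: that T_def power_mult_distrib)
    then show ?thesis by (simp only: power_add mult_ac)
  qed
  have "breakpoints p q m (Suc (Suc j)) = breakpoints p q m (Suc j) \<union> S"
    by (auto simp: breakpoints_def S_def T_def D_def less_Suc_eq)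
  moreover have "breakpoints p q m (Suc j) \<inter> S = {M. M < T \<and> E dvd M}"
  proof -
    have "E dvd M" if "k < Suc j" "D k dvd M" "D (Suc j) dvd M" for k M
    proof -
      have "p ^ (m - j) dvd p ^ (m - k)" using that by (intro le_imp_power_dvd) simp
      then have "p ^ (m - j) dvd M" using that(2) unfolding D_def by (meson dvd_mult_left dvd_trans)
      moreover have "q ^ Suc j dvd M" using that(3) unfolding D_def by (meson dvd_mult_right)
      moreover have "coprime (p ^ (m - j)) (q ^ Suc j)" using assms(3) by simp
      ultimately show ?thesis unfolding E_def by (simp add: divides_mult)
    qed
    moreover have "D j dvd E" "D (Suc j) dvd E"
      unfolding D_def E_def by (intro mult_dvd_mono le_imp_power_dvd; simp)+
    ultimately show ?thesis
      unfolding breakpoints_def S_def T_def[symmetric] D_def[symmetric]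
      by (auto intro: dvd_trans)
  qed
  moreover have "card S = p ^ Suc (Suc j) * q ^ (Suc m - Suc j)"
  proof -
    have "T = D (Suc j) * (p ^ Suc (Suc j) * q ^ (Suc m - Suc j))"
      unfolding D_def by (rule T) (use Suc.prems in auto)
    then show ?thesis using card_multiples_less[of "D (Suc j)"] assms by (simp add: S_def D_def)
  qed
  moreover have "card {M. M < T \<and> E dvd M} = p ^ Suc j * q ^ (m - j)"
  proof -
    have "T = E * (p ^ Suc j * q ^ (m - j))"
      unfolding E_def by (rule T) (use Suc.prems in auto)
    then show ?thesis using card_multiples_less[of E] assms by (simp add: E_def)
  qed
  moreover have "finite (breakpoints p q m (Suc j))" "finite S"
    by (auto simp: breakpoints_def S_def)
  ultimately have "card (breakpoints p q m (Suc (Suc j))) + p ^ Suc j * q ^ (m - j) =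
      card (breakpoints p q m (Suc j)) + p ^ Suc (Suc j) * q ^ (Suc m - Suc j)"
    using card_Un_Int[of "breakpoints p q m (Suc j)" S] by simp
  with Suc show ?case by simp
qed

theorem theorem3p15:
  fixes p q n :: nat
  assumes "p > q" and "q > 1" and "coprime p q" and "n \<ge> 1"
  shows "real (complexity (trace_subshift p q) n) =
           real p * real q * (real p ^ (n - 1) - real q ^ (n - 1)) * ((real q - 1) / (real p - real q))
             + real p ^ n * real q"
proof -
  from assms(4) obtain m where n: "n = Suc m" by (cases n) auto
  have pos: "p > 0" "q > 0" using assms by auto
  define c where "c = card (breakpoints p q m (Suc m))"
  have c: "complexity (trace_subshift p q) n = c"
    unfolding complexity_def c_def n subwords_trace_subshift_eq_quotient_words[OF pos]
      range_quotient_word[OF pos]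
    by (rule card_image[OF inj_on_quotient_word[OF pos assms(3)]])
  \<comment> \<open>\<open>G\<close> is \<open>(p ^ m - q ^ m) / (p - q)\<close> without division.
    The overlaps sum to \<open>p * q * G\<close>; the multiples sum to \<open>q\<close> times that,
    plus the last term \<open>p ^ Suc m * q\<close>.\<close>
  define G where "G = (\<Sum>i<m. p ^ i * q ^ (m - Suc i))"
  have "p ^ Suc i * q ^ (m - i) = p * q * (p ^ i * q ^ (m - Suc i))" if "i < m" for i
    using that by (simp flip: Suc_diff_Suc)
  then have "(\<Sum>i<m. p ^ Suc i * q ^ (m - i)) = p * q * G"
    unfolding G_def sum_distrib_left by (intro sum.cong) auto
  moreover have "(\<Sum>i<m. p ^ Suc i * q ^ (Suc m - i)) = q * (\<Sum>i<m. p ^ Suc i * q ^ (m - i))"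
    unfolding sum_distrib_left by (intro sum.cong refl) (simp add: Suc_diff_le)
  ultimately have "c + p * q * G = q * (p * q * G) + p ^ Suc m * q"
    using card_breakpoints[OF pos assms(3) order_refl, of m]
    by (simp add: c_def lessThan_Suc_atMost[symmetric])
  then have "real c + real p * real q * real G = real q * (real p * real q * real G) + real p ^ Suc m * real q"
    by (metis of_nat_add of_nat_mult of_nat_power)
  then have card: "real c = real p * real q * real G * (real q - 1) + real p ^ Suc m * real q"
    by (simp add: algebra_simps)
  have "real p ^ m - real q ^ m = (real p - real q) * real G"
    by (simp add: G_def power_diff_sumr2 mult.commute)
  then show ?thesis
    using assms(1) unfolding c card unfolding n by simp
qed

end
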